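(* Let $m\ge 2$ be an integer. Then for all $j\ge 0$: (i) $sp(2mj+1,m)\equiv 1\pmod 4$, and (ii) $sp(2mj+m+1,m)\equiv 3\pmod 4$.
   Context: For fixed $m>1$, $sp(n,m)$ is defined by: $sp(n,m)=0$ for $n<0$, $sp(0,m)=1$, $sp(n,m)=1$ for $1\le n\le m-1$, and for $n\ge m$: $sp(n,m)=sp(n/m,m)$ if $m\mid n$, and $sp(n,m)=2sp(n-r,m)+sp(n-m,m)$ if $n\equiv r\pmod m$ with $0<r<m$. (It counts semi-$m$-Pell compositions of $n$.) *)

theory Defs
  imports "HOL-Number_Theory.Cong"
begin

text \<open>The recurrence is only meant for \<open>m > 1\<close>; the value \<open>0\<close> for \<open>m \<le> 1\<close> is a dummy that
  makes the function total.\<close>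

function sp :: "int \<Rightarrow> int \<Rightarrow> nat" where
  "sp n m =
    (if m \<le> 1 then 0
     else if n < 0 then 0
     else if n = 0 then 1
     else if n \<le> m - 1 then 1
     else if m dvd n then sp (n div m) m
     else 2 * sp (n - n mod m) m + sp (n - m) m)"
  by pat_completeness auto

termination
proof (relation "measure (\<lambda>(n, m). nat n)", goal_cases)
  case 1
  show ?case by simp
next
  case (2 n m)
  then show ?case by (simp add: int_div_less_self)
next
  case (3 n m)
  moreover from 3 have "0 < n mod m"
    by (smt (verit) dvd_eq_mod_eq_0 pos_mod_sign)
  ultimately show ?case by simp
next
  case (4 n m)
  then show ?case by simp
qed

declare sp.simps [simp del]

lemma sp_neg: "m > 1 \<Longrightarrow> n < 0 \<Longrightarrow> sp n m = 0"
  by (simp add: sp.simps)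

lemma sp_zero: "m > 1 \<Longrightarrow> sp 0 m = 1"
  by (simp add: sp.simps)

lemma sp_small: "m > 1 \<Longrightarrow> 1 \<le> n \<Longrightarrow> n \<le> m - 1 \<Longrightarrow> sp n m = 1"
  by (simp add: sp.simps)

lemma sp_dvd: "m > 1 \<Longrightarrow> n \<ge> m \<Longrightarrow> m dvd n \<Longrightarrow> sp n m = sp (n div m) m"
  by (subst sp.simps) simp

lemma sp_not_dvd:
  assumes "m > 1" "n \<ge> m" "[n = r] (mod m)" "0 < r" "r < m"
  shows "sp n m = 2 * sp (n - r) m + sp (n - m) m"
proof -
  have "n mod m = r" using assms by (simp add: cong_def)
  moreover from this have "\<not> m dvd n" using assms by (auto simp: dvd_eq_mod_eq_0)
  ultimately show ?thesis using assms by (subst sp.simps) simp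
qed

end

theory Submission imports Defs begin

text \<open>For \<open>n >= 0\<close> the recurrence either copies an earlier value or adds an even
  number to one, so every value is odd (\<open>odd_sp\<close>). Along the progression of numbers
  congruent to 1 modulo \<open>m\<close>, each step of length \<open>m\<close> adds twice such an
  odd value, that is, 2 modulo 4. Starting from \<open>sp 1 m = 1\<close>, this gives 1 + 2k at mk +
  1 (\<open>sp_mult_add_one_cong\<close>); the two claims are the cases of even and odd k.\<close>

lemma odd_sp:
  assumes "m > 1" "n \<ge> 0"
  shows "odd (sp n m)"
  using assms
proof (induction n m rule: sp.induct)
  case (1 n m)
  consider "n = 0" | "1 \<le> n" "n \<le> m - 1" | "n \<ge> m" "m dvd n" | "n \<ge> m" "\<not> m dvd n"
    using "1.prems" by linarith
  then show ?case
  proof cases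
    case 3
    then have "odd (sp (n div m) m)"
      using "1.prems" by (intro "1.IH"(1)) (auto simp: pos_imp_zdiv_nonneg_iff)
    then show ?thesis
      using 3 "1.prems" by (simp add: sp_dvd)
  next
    case 4
    \<comment> \<open>The other recursive value enters doubled, so this one alone decides the
      parity.\<close>
    then have "odd (sp (n - m) m)"
      using "1.prems" by (intro "1.IH"(3)) auto
    then show ?thesis
      using 4 "1.prems" by (subst sp.simps) simp
  qed (use "1.prems" in \<open>simp_all add: sp_zero sp_small\<close>)
qed

text \<open>Since \<open>m > 1\<close>, the residue in the recurrence is \<open>r = 1\<close>, so
  the doubled term is the value at an exact multiple of \<open>m\<close> and the remaining term is
  the preceding member of the progression.\<close>

lemma sp_mult_add_one_cong:
  assumes "m > 1"
  shows "[sp (m * int k + 1) m = 1 + 2 * k] (mod 4)"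
proof (induction k)
  case 0
  then show ?case using assms by (simp add: sp_small)
next
  case (Suc k)
  have "[m * int (Suc k) + 1 = 1] (mod m)"
    by (simp add: cong_iff_dvd_diff)
  moreover have "m * int (Suc k) + 1 \<ge> m"
    using assms by (simp add: algebra_simps)
  ultimately have rec: "sp (m * int (Suc k) + 1) m
      = 2 * sp (m * int (Suc k)) m + sp (m * int k + 1) m"
    using sp_not_dvd[of m "m * int (Suc k) + 1" 1] assms by (simp add: algebra_simps)
  have "odd (sp (m * int (Suc k)) m)"
    using assms by (intro odd_sp) auto
  then obtain b where "sp (m * int (Suc k)) m = 2 * b + 1"
    by (elim oddE)
  \<comment> \<open>Oddness suffices here: 2(2b + 1) = 4b + 2.\<close>
  then have "[2 * sp (m * int (Suc k)) m = 2] (mod 4)"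
    by (simp add: cong_def) presburger
  from cong_add[OF this Suc.IH] show ?case
    unfolding rec by simp
qed

theorem theorem4p2:
  fixes m :: int
  assumes "m \<ge> 2"
  shows "\<forall>j::int. j \<ge> 0 \<longrightarrow>
           [sp (2 * m * j + 1) m = 1] (mod 4) \<and>
           [sp (2 * m * j + m + 1) m = 3] (mod 4)"
proof (intro allI impI)
  fix j :: int
  assume "j \<ge> 0"
  then obtain i where j: "j = int i"
    using nonneg_int_cases by blast
  \<comment> \<open>The two arguments are mk + 1 with k = 2i and k = 2i + 1.\<close>
  have "[sp (2 * m * j + 1) m = 1 + 2 * (2 * i)] (mod 4)"
    using sp_mult_add_one_cong[of m "2 * i"] assms by (simp add: j algebra_simps)
  moreover have "[sp (2 * m * j + m + 1) m = 1 + 2 * (2 * i + 1)] (mod 4)"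
    using sp_mult_add_one_cong[of m "2 * i + 1"] assms by (simp add: j algebra_simps)
  moreover have "[1 + 2 * (2 * i) = 1] (mod 4)" "[1 + 2 * (2 * i + 1) = 3] (mod 4)"
    unfolding cong_def by presburger+
  ultimately show "[sp (2 * m * j + 1) m = 1] (mod 4) \<and> [sp (2 * m * j + m + 1) m = 3] (mod 4)"
    by (blast intro: cong_trans)
qed

end
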